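(* Let $A, B\in\mathcal{B}(\mathcal{H})$ be positive operators. Then $A\natural B$ is the unique positive solution $\mathbb{X}$ of the equation $$\mathbb{X}A^{-1}\mathbb{X}=\left|A^{-\frac12}B^{\frac12}A^{\frac12}\right|^2 .$$
   Context: $\mathcal{B}(\mathcal{H})$ is the $C^*$-algebra of bounded linear operators on a complex Hilbert space $\mathcal{H}$. "Positive" means $\langle Tx,x\rangle>0$ for all nonzero $x$ and $T$ is invertible in $\mathcal{B}(\mathcal{H})$. For $T\in\mathcal{B}(\mathcal{H})$, $|T|^2=T^*T$; thus $\left|A^{-\frac12}B^{\frac12}A^{\frac12}\right|^2=A^{\frac12}B^{\frac12}A^{-1}B^{\frac12}A^{\frac12}$. For positive $A,B$, define $A\natural B:=A^{\frac12}\left(B^{\frac12}A^{-1}B^{\frac12}\right)^{\frac12}A^{\frac12}$. *)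

theory Defs
  imports "HOL-Analysis.Analysis"
begin

section \<open>Complex Hilbert spaces\<close>

class complex_vector = real_vector +
  fixes scaleC :: "complex \<Rightarrow> 'a \<Rightarrow> 'a"  (infixr \<open>*\<^sub>C\<close> 75)
  assumes scaleC_add_right: "c *\<^sub>C (x + y) = c *\<^sub>C x + c *\<^sub>C y"
    and scaleC_add_left: "(c + d) *\<^sub>C x = c *\<^sub>C x + d *\<^sub>C x"
    and scaleC_scaleC: "c *\<^sub>C d *\<^sub>C x = (c * d) *\<^sub>C x"
    and scaleC_one: "1 *\<^sub>C x = x"
    and scaleR_eq_scaleC: "r *\<^sub>R x = complex_of_real r *\<^sub>C x"

text \<open>
  The inner product is linear in the first argument.  Its real part is the inner product of the
  underlying real space, so positive definiteness, the norm, and the topology are those inherited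
  from the class \<open>real_inner\<close>; see \<open>cinner_self\<close> below.
\<close>

class complex_inner = complex_vector + real_inner +
  fixes cinner :: "'a \<Rightarrow> 'a \<Rightarrow> complex"
  assumes cinner_commute: "cinner x y = cnj (cinner y x)"
    and cinner_add_left: "cinner (x + y) z = cinner x z + cinner y z"
    and cinner_scaleC_left: "cinner (c *\<^sub>C x) y = c * cinner x y"
    and inner_eq_Re_cinner: "inner x y = Re (cinner x y)"

class chilbert_space = complex_inner + complete_space

lemma cinner_self: "cinner x x = complex_of_real ((norm x)\<^sup>2)"
  for x :: "'a::complex_inner"
proof (rule complex_eqI)
  show "Re (cinner x x) = Re (complex_of_real ((norm x)\<^sup>2))"
    by (simp add: inner_eq_Re_cinner[symmetric] power2_norm_eq_inner)
  have "Im (cinner x x) = - Im (cinner x x)"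
    by (metis cinner_commute cnj.sel(2))
  then show "Im (cinner x x) = Im (complex_of_real ((norm x)\<^sup>2))" by simp
qed

instantiation complex :: chilbert_space
begin

definition scaleC_complex :: "complex \<Rightarrow> complex \<Rightarrow> complex"
  where "scaleC_complex c x = c * x"

definition cinner_complex :: "complex \<Rightarrow> complex \<Rightarrow> complex"
  where "cinner_complex x y = x * cnj y"

instance
  by standard
    (simp_all add: scaleC_complex_def cinner_complex_def algebra_simps scaleR_conv_of_real
      inner_complex_def)

end

section \<open>Bounded operators\<close>

typedef (overloaded) ('a::complex_inner) bop =
  "{T :: 'a \<Rightarrow> 'a. bounded_linear T \<and> (\<forall>c x. T (c *\<^sub>C x) = c *\<^sub>C T x)}"
  morphisms bop_apply Bop
  by (rule exI[of _ "\<lambda>x. x"]) (simp add: bounded_linear_ident)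

setup_lifting type_definition_bop

instantiation bop :: (complex_inner) monoid_mult
begin

lift_definition one_bop :: "'a bop" is "\<lambda>x. x"
  by (simp add: bounded_linear_ident)

lift_definition times_bop :: "'a bop \<Rightarrow> 'a bop \<Rightarrow> 'a bop" is "\<lambda>S T x. S (T x)"
  by (simp add: bounded_linear_compose)

instance
  by standard (transfer, simp)+

end

definition op_invertible :: "'a::complex_inner bop \<Rightarrow> bool"
  where "op_invertible T \<longleftrightarrow> (\<exists>S. S * T = 1 \<and> T * S = 1)"

definition op_inv :: "'a::complex_inner bop \<Rightarrow> 'a bop"
  where "op_inv T = (THE S. S * T = 1 \<and> T * S = 1)"

definition op_adj :: "'a::complex_inner bop \<Rightarrow> 'a bop"
  where "op_adj T = (THE S. \<forall>x y. cinner (bop_apply S x) y = cinner x (bop_apply T y))"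

definition positive_op :: "'a::complex_inner bop \<Rightarrow> bool"
  where "positive_op T \<longleftrightarrow>
    (\<forall>x. x \<noteq> 0 \<longrightarrow> cinner (bop_apply T x) x \<in> \<real> \<and> Re (cinner (bop_apply T x) x) > 0) \<and>
    op_invertible T"

definition nonneg_op :: "'a::complex_inner bop \<Rightarrow> bool"
  where "nonneg_op T \<longleftrightarrow>
    (\<forall>x. cinner (bop_apply T x) x \<in> \<real> \<and> Re (cinner (bop_apply T x) x) \<ge> 0)"

definition op_sqrt :: "'a::complex_inner bop \<Rightarrow> 'a bop"
  where "op_sqrt T = (THE S. nonneg_op S \<and> S * S = T)"

definition op_abs :: "'a::complex_inner bop \<Rightarrow> 'a bop"
  where "op_abs T = op_sqrt (op_adj T * T)"

definition op_natural :: "'a::complex_inner bop \<Rightarrow> 'a bop \<Rightarrow> 'a bop"  (infixl \<open>\<natural>\<close> 70)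
  where "A \<natural> B = op_sqrt A * op_sqrt (op_sqrt B * op_inv A * op_sqrt B) * op_sqrt A"

text \<open>
  The descriptions above denote at most one operator: for inverses and adjoints this is immediate;
  for square roots it is the uniqueness of the nonnegative root.
\<close>

lemma op_inv_eqI: "op_inv T = S" if "S * T = 1" "T * S = 1"
  unfolding op_inv_def
proof (rule the_equality)
  fix R assume "R * T = 1 \<and> T * R = 1"
  then show "R = S" using that by (metis mult.assoc mult_1_left mult_1_right)
qed (use that in simp)

lemma op_adj_eqI: "op_adj T = S"
  if "\<And>x y. cinner (bop_apply S x) y = cinner x (bop_apply T y)"
  unfolding op_adj_def
proof (rule the_equality)
  fix R assume R: "\<forall>x y. cinner (bop_apply R x) y = cinner x (bop_apply T y)"
  have "bop_apply R x = bop_apply S x" for x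
  proof -
    have "inner (bop_apply R x) y = inner (bop_apply S x) y" for y
      using R that by (simp add: inner_eq_Re_cinner)
    then show ?thesis by (metis vector_eq_rdot)
  qed
  then show "R = S" by (simp add: bop_apply_inject[symmetric] fun_eq_iff)
qed (use that in simp)

end

theory Submission
  imports Defs
begin

text \<open>
  Conjugating by \<open>A\<^sup>-\<^sup>1\<^sup>/\<^sup>2\<close> turns the equation into \<open>Y\<^sup>2 = B\<^sup>1\<^sup>/\<^sup>2 A\<^sup>-\<^sup>1 B\<^sup>1\<^sup>/\<^sup>2\<close> for the positive operator
  \<open>Y = A\<^sup>-\<^sup>1\<^sup>/\<^sup>2 X A\<^sup>-\<^sup>1\<^sup>/\<^sup>2\<close>, so the claim reduces to existence and uniqueness of positive square roots of
  positive invertible operators. Such an operator \<open>T\<close> is coercive, hence \<open>K = 1 - t T\<close> has norm less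
  than one for small \<open>t > 0\<close>, and the map \<open>Y \<mapsto> (K + Y\<^sup>2) / 2\<close> is a contraction of the ball of radius
  \<open>\<parallel>K\<parallel>\<close>. Its fixed point gives the root \<open>1 - Y\<close> of \<open>t T\<close>, which commutes with everything that
  commutes with \<open>T\<close>, in particular with any other square root.
\<close>

instance chilbert_space \<subseteq> banach ..

section \<open>Complex inner products\<close>

lemma cinner_add_right: "cinner x (y + z) = cinner x y + cinner x z"
  for x y z :: "'a::complex_inner"
  by (metis cinner_commute cinner_add_left complex_cnj_add)

lemma cinner_scaleC_right: "cinner x (c *\<^sub>C y) = cnj c * cinner x y"
  for x y :: "'a::complex_inner"
  by (metis cinner_commute cinner_scaleC_left complex_cnj_mult)

text \<open>Lets complex symmetry be recovered from real symmetry, by testing at both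
  \<open>x\<close> and \<open>\<i> *\<^sub>C x\<close>.\<close>

lemma Im_cinner: "Im (cinner x y) = - inner (\<i> *\<^sub>C x) y"
  for x y :: "'a::complex_inner"
  by (simp add: inner_eq_Re_cinner cinner_scaleC_left)

lemma norm_scaleC: "norm (c *\<^sub>C x) = cmod c * norm x"
  for x :: "'a::complex_inner"
proof -
  have "complex_of_real ((norm (c *\<^sub>C x))\<^sup>2) = (c * cnj c) * complex_of_real ((norm x)\<^sup>2)"
    unfolding cinner_self[symmetric] by (simp add: cinner_scaleC_left cinner_scaleC_right)
  also have "\<dots> = complex_of_real ((cmod c * norm x)\<^sup>2)"
    by (simp only: complex_norm_square[symmetric] power_mult_distrib of_real_mult)
  finally have "(norm (c *\<^sub>C x))\<^sup>2 = (cmod c * norm x)\<^sup>2"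
    by (simp only: of_real_eq_iff)
  then show ?thesis by (simp add: power2_eq_iff_nonneg)
qed

text \<open>Makes complex scalars eligible as operators that commute with \<open>T\<close>; this
  later gives complex linearity of the square root.\<close>

lemma bounded_linear_scaleC: "bounded_linear (\<lambda>x::'a::complex_inner. c *\<^sub>C x)"
proof (rule bounded_linear_intro[where K = "cmod c"])
  show "c *\<^sub>C (r *\<^sub>R x) = r *\<^sub>R (c *\<^sub>C x)" for r and x :: 'a
    by (simp add: scaleR_eq_scaleC scaleC_scaleC mult.commute)
qed (simp_all add: scaleC_add_right norm_scaleC mult.commute)

section \<open>Positive operators\<close>

lemma bop_apply_times [simp]: "bop_apply (S * T) x = bop_apply S (bop_apply T x)"
  by transfer simp

lemma bop_apply_one [simp]: "bop_apply 1 x = x"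
  by transfer simp

lemma bop_eqI: "(\<And>x. bop_apply S x = bop_apply T x) \<Longrightarrow> S = T"
  by (simp add: bop_apply_inject[symmetric] fun_eq_iff)

lemma bounded_linear_bop_apply: "bounded_linear (bop_apply T)"
  using bop_apply[of T] by simp

lemma linear_bop_apply: "linear (bop_apply T)"
  by (rule bounded_linear.linear[OF bounded_linear_bop_apply])

lemma bop_apply_scaleC: "bop_apply T (c *\<^sub>C x) = c *\<^sub>C bop_apply T x"
  using bop_apply[of T] by simp

text \<open>Polarization: a quadratic form with only real values comes from a Hermitian
  form.\<close>

lemma nonneg_op_symmetric:
  assumes "nonneg_op T"
  shows "cinner (bop_apply T x) y = cinner x (bop_apply T y)"
proof -
  let ?T = "bop_apply T"
  have real: "Im (cinner (?T z) z) = 0" for z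
    using assms by (simp add: nonneg_op_def complex_is_Real_iff)
  have Im: "Im (cinner (?T x) y) + Im (cinner (?T y) x) = 0" for x y
    using real[of "x + y"] real[of x] real[of y]
    by (simp add: linear_add[OF linear_bop_apply] cinner_add_left cinner_add_right)
  \<comment> \<open>Replacing \<open>y\<close> by \<open>\<i> *\<^sub>C y\<close> turns the identity
    for imaginary parts into one for real parts.\<close>
  have "Re (cinner (?T x) y) = Re (cinner (?T y) x)"
    using Im[of x "\<i> *\<^sub>C y"]
    by (simp add: bop_apply_scaleC cinner_scaleC_left cinner_scaleC_right)
  with Im[of x y] have "cinner (?T x) y = cnj (cinner (?T y) x)"
    by (simp add: complex_eq_iff)
  then show ?thesis by (metis cinner_commute)
qed

lemma nonneg_op_inner_symmetric:
  "nonneg_op T \<Longrightarrow> inner (bop_apply T x) y = inner x (bop_apply T y)"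
  by (simp add: inner_eq_Re_cinner nonneg_op_symmetric)

lemma positive_imp_nonneg_op: "positive_op T \<Longrightarrow> nonneg_op T"
  unfolding positive_op_def nonneg_op_def
proof (intro allI)
  fix x assume *: "(\<forall>x. x \<noteq> 0 \<longrightarrow> cinner (bop_apply T x) x \<in> \<real> \<and>
      0 < Re (cinner (bop_apply T x) x)) \<and> op_invertible T"
  show "cinner (bop_apply T x) x \<in> \<real> \<and> 0 \<le> Re (cinner (bop_apply T x) x)"
  proof (cases "x = 0")
    case True
    then show ?thesis by (simp add: linear_0[OF linear_bop_apply] cinner_self)
  next
    case False
    with * show ?thesis by (simp add: less_imp_le)
  qed
qed

lemma positive_opI:
  assumes "\<And>x y. cinner (bop_apply T x) y = cinner x (bop_apply T y)"
    and "\<And>x. x \<noteq> 0 \<Longrightarrow> inner (bop_apply T x) x > 0"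
    and "S * T = 1" "T * S = 1"
  shows "positive_op T"
proof -
  have "cinner (bop_apply T x) x \<in> \<real>" for x
    by (metis Reals_cnj_iff assms(1) cinner_commute)
  then show ?thesis
    using assms by (auto simp: positive_op_def inner_eq_Re_cinner op_invertible_def)
qed

lemma positive_op_inner_pos:
  "positive_op T \<Longrightarrow> x \<noteq> 0 \<Longrightarrow> inner (bop_apply T x) x > 0"
  by (simp add: positive_op_def inner_eq_Re_cinner)

lemma nonneg_op_inner_nonneg: "nonneg_op T \<Longrightarrow> inner (bop_apply T x) x \<ge> 0"
  by (simp add: nonneg_op_def inner_eq_Re_cinner)

lemma op_inv_left: "op_invertible T \<Longrightarrow> op_inv T * T = 1"
  and op_inv_right: "op_invertible T \<Longrightarrow> T * op_inv T = 1"
  unfolding op_invertible_def using op_inv_eqI by blast+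

lemma positive_imp_op_invertible: "positive_op T \<Longrightarrow> op_invertible T"
  by (simp add: positive_op_def)

lemmas positive_op_inv_left = op_inv_left[OF positive_imp_op_invertible]
  and positive_op_inv_right = op_inv_right[OF positive_imp_op_invertible]

text \<open>Writing \<open>x\<close> as \<open>T\<close> applied to its preimage carries symmetry
  and positivity over to the inverse.\<close>

lemma positive_op_inv:
  assumes "positive_op T"
  shows "positive_op (op_inv T)"
proof -
  let ?V = "op_inv T"
  note inv = positive_op_inv_left[OF assms] positive_op_inv_right[OF assms]
  note sym = nonneg_op_symmetric[OF positive_imp_nonneg_op[OF assms]]
  have TV: "bop_apply T (bop_apply ?V x) = x" for x
    using arg_cong[OF inv(2), of "\<lambda>Z. bop_apply Z x"] by simp
  show ?thesis
  proof (rule positive_opI[OF _ _ inv(2) inv(1)])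
    show "cinner (bop_apply ?V x) y = cinner x (bop_apply ?V y)" for x y
      using sym[of "bop_apply ?V x" "bop_apply ?V y"] by (simp add: TV)
    show "inner (bop_apply ?V x) x > 0" if "x \<noteq> 0" for x
    proof -
      have "bop_apply ?V x \<noteq> 0"
        using that TV[of x] linear_0[OF linear_bop_apply] by metis
      then show ?thesis
        using positive_op_inner_pos[OF assms, of "bop_apply ?V x"]
        by (simp add: TV inner_commute)
    qed
  qed
qed

text \<open>Since \<open>S\<close> is symmetric, the quadratic form at \<open>x\<close> is that of
  \<open>T\<close> at the image of \<open>x\<close> under \<open>S\<close>, which is nonzero when
  \<open>x\<close> is.\<close>

lemma positive_op_congruence:
  assumes S: "positive_op S" and T: "positive_op T"
  shows "positive_op (S * T * S)"
proof (rule positive_opI)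
  note symS = nonneg_op_symmetric[OF positive_imp_nonneg_op[OF S]]
  note symT = nonneg_op_symmetric[OF positive_imp_nonneg_op[OF T]]
  note invS = positive_op_inv_left[OF S] positive_op_inv_right[OF S]
  note invT = positive_op_inv_left[OF T] positive_op_inv_right[OF T]
  show "cinner (bop_apply (S * T * S) x) y = cinner x (bop_apply (S * T * S) y)" for x y
    by (simp add: symS symT)
  show "inner (bop_apply (S * T * S) x) x > 0" if "x \<noteq> 0" for x
  proof -
    have "bop_apply S x \<noteq> 0"
      using positive_op_inner_pos[OF S that] by auto
    then show ?thesis
      using positive_op_inner_pos[OF T, of "bop_apply S x"]
      by (simp add: nonneg_op_inner_symmetric[OF positive_imp_nonneg_op[OF S]])
  qed
  show "op_inv S * op_inv T * op_inv S * (S * T * S) = 1"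
    "S * T * S * (op_inv S * op_inv T * op_inv S) = 1"
    by (metis invS invT mult.assoc mult_1_left)+
qed

text \<open>Invertibility upgrades pointwise positivity to a uniform lower bound: a bound
  \<open>N\<close> for the inverse yields the constant \<open>1 / N\<close>.\<close>

lemma positive_op_coercive:
  assumes "positive_op T"
  obtains \<epsilon> where "\<epsilon> > 0" "\<And>x. inner (bop_apply T x) x \<ge> \<epsilon> * (norm x)\<^sup>2"
proof -
  let ?T = "bop_apply T" and ?V = "bop_apply (op_inv T)"
  note nonneg = positive_imp_nonneg_op[OF assms]
  have TV: "?T (?V x) = x" for x
    using arg_cong[OF positive_op_inv_right[OF assms], of "\<lambda>Z. bop_apply Z x"] by simp
  obtain N where N: "N > 0" "\<And>x. norm (?V x) \<le> norm x * N"
    using bounded_linear.pos_bounded[OF bounded_linear_bop_apply] by blast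
  have "inner (?T x) x \<ge> (1 / N) * (norm x)\<^sup>2" for x
  proof -
    \<comment> \<open>A multiple of \<open>?V x\<close> reduces the cross terms to
      \<open>inner x x\<close>. Nonnegativity at \<open>x - ?y\<close> then gives the coefficient
      \<open>2 / N - 1 / N\<close>.\<close>
    let ?y = "(1 / N) *\<^sub>R ?V x"
    have "0 \<le> inner (?T (x - ?y)) (x - ?y)"
      by (rule nonneg_op_inner_nonneg[OF nonneg])
    also have "\<dots> = inner (?T x) x - 2 / N * inner x x + (1 / N)\<^sup>2 * inner x (?V x)"
      using nonneg_op_inner_symmetric[OF nonneg, of x "?V x"]
      by (simp add: linear_diff[OF linear_bop_apply] linear_cmul[OF linear_bop_apply] TV
          inner_diff_left inner_diff_right power2_eq_square diff_divide_distrib)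
    also have "inner x (?V x) \<le> N * (norm x)\<^sup>2"
    proof -
      have "inner x (?V x) \<le> norm x * norm (?V x)"
        by (rule norm_cauchy_schwarz)
      also have "\<dots> \<le> norm x * (norm x * N)"
        by (intro mult_left_mono N) simp
      finally show ?thesis by (simp add: power2_eq_square mult_ac)
    qed
    finally show ?thesis
      using N(1) by (simp add: dot_square_norm power2_eq_square field_simps)
  qed
  with N(1) show ?thesis by (intro that[of "1 / N"]) auto
qed

section \<open>Square roots\<close>

text \<open>The equation for \<open>Y\<close> says \<open>(1 - Y)\<^sup>2 = 1 - K\<close>. Banach's
  theorem is applied among real bounded linear maps, so \<open>Z\<close> may be merely real
  linear.\<close>

lemma blinfun_square_fixed_point:
  fixes K :: "'a::{real_inner, banach} \<Rightarrow>\<^sub>L 'a"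
  assumes "norm K < 1" and symK: "\<And>x y. inner (K x) y = inner x (K y)"
  obtains Y :: "'a \<Rightarrow>\<^sub>L 'a" where
    "norm Y < 1" "\<And>x. 2 *\<^sub>R Y x = K x + Y (Y x)" "\<And>x y. inner (Y x) y = inner x (Y y)"
    "\<And>Z x. bounded_linear Z \<Longrightarrow> (\<And>x. K (Z x) = Z (K x)) \<Longrightarrow> Y (Z x) = Z (Y x)"
proof -
  define F where "F Y = (1/2) *\<^sub>R (K + (Y o\<^sub>L Y))" for Y :: "'a \<Rightarrow>\<^sub>L 'a"
  define C where "C = {Z. bounded_linear Z \<and> (\<forall>x. K (Z x) = Z (K x))}"
  \<comment> \<open>Symmetry and commutation with \<open>C\<close> are closed conditions preserved
    by \<open>F\<close>. Building them into the domain lets the fixed point inherit them.\<close>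
  define D :: "('a \<Rightarrow>\<^sub>L 'a) set" where
    "D = cball 0 (norm K) \<inter> (\<Inter>x y. {Y :: 'a \<Rightarrow>\<^sub>L 'a. inner (Y x) y = inner x (Y y)})
      \<inter> (\<Inter>Z\<in>C. \<Inter>x. {Y :: 'a \<Rightarrow>\<^sub>L 'a. Y (Z x) = Z (Y x)})"
  have F_apply: "F Y x = (1/2) *\<^sub>R (K x + Y (Y x))" for Y x
    by (simp add: F_def blinfun.bilinear_simps)
  have ev: "continuous_on UNIV (\<lambda>Y :: 'a \<Rightarrow>\<^sub>L 'a. Y x)" for x
    by (intro linear_continuous_on blinfun.bounded_linear_left)
  have "closed {Y :: 'a \<Rightarrow>\<^sub>L 'a. Y (Z x) = Z (Y x)}" if "Z \<in> C" for Z x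
  proof -
    have "bounded_linear Z" using that by (simp add: C_def)
    then show ?thesis
      by (rule closed_Collect_eq[OF ev bounded_linear.continuous_on[OF _ ev]])
  qed
  then have "closed D"
    unfolding D_def
    by (intro closed_Int closed_INT closed_cball ballI)
      (auto intro!: closed_Collect_eq continuous_on_inner ev)
  then have "complete D" by (simp add: complete_eq_closed)
  moreover have "0 \<in> D"
    by (simp add: D_def C_def bounded_linear.linear linear_0)
  moreover have "F ` D \<subseteq> D"
  proof (rule image_subsetI)
    fix Y assume Y: "Y \<in> D"
    have norm: "norm Y \<le> norm K" using Y by (simp add: D_def)
    have "norm (F Y) \<le> (1/2) * (norm K + norm (Y o\<^sub>L Y))"
      unfolding F_def by (simp add: norm_triangle_ineq)
    also have "norm (Y o\<^sub>L Y) \<le> norm Y * norm Y" by (rule norm_blinfun_compose)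
    also have "\<dots> \<le> norm K * 1" using norm assms(1) by (intro mult_mono) auto
    finally have "norm (F Y) \<le> norm K" by simp
    moreover have "inner (F Y x) y = inner x (F Y y)" for x y
      using Y by (simp add: F_apply D_def symK inner_add_left inner_add_right)
    moreover have "F Y (Z x) = Z (F Y x)" if "Z \<in> C" for Z x
    proof -
      have "linear Z" using that by (simp add: C_def bounded_linear.linear)
      then show ?thesis
        using Y that by (simp add: F_apply D_def C_def linear_add linear_cmul)
    qed
    ultimately show "F Y \<in> D" by (simp add: D_def)
  qed
  moreover have "dist (F Y) (F Y') \<le> norm K * dist Y Y'" if "Y \<in> D" "Y' \<in> D" for Y Y'
  proof -
    have norms: "norm Y \<le> norm K" "norm Y' \<le> norm K" using that by (simp_all add: D_def)
    \<comment> \<open>Noncommutative difference of squares: insert the mixed product of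
      \<open>Y\<close> and \<open>Y'\<close>.\<close>
    have "F Y - F Y' = (1/2) *\<^sub>R ((Y o\<^sub>L (Y - Y')) + ((Y - Y') o\<^sub>L Y'))"
      by (rule blinfun_eqI) (simp add: F_apply blinfun.bilinear_simps algebra_simps)
    then have "dist (F Y) (F Y') = (1/2) * norm ((Y o\<^sub>L (Y - Y')) + ((Y - Y') o\<^sub>L Y'))"
      by (simp add: dist_norm)
    also have "\<dots> \<le> (1/2) * (norm Y * norm (Y - Y') + norm (Y - Y') * norm Y')"
      by (intro mult_left_mono norm_triangle_le add_mono norm_blinfun_compose) simp
    also have "\<dots> \<le> (1/2) * (norm K * norm (Y - Y') + norm (Y - Y') * norm K)"
      by (intro mult_left_mono add_mono mult_right_mono norms) auto
    finally show ?thesis by (simp add: dist_norm mult.commute)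
  qed
  ultimately have "\<exists>!Y\<in>D. F Y = Y"
    using assms(1) by (intro Banach_fix[of D "norm K" F]) auto
  then obtain Y where Y: "Y \<in> D" "F Y = Y" by blast
  show ?thesis
  proof (rule that[of Y])
    show "norm Y < 1" using Y(1) assms(1) by (simp add: D_def)
    show "2 *\<^sub>R Y x = K x + Y (Y x)" for x
    proof -
      have "2 *\<^sub>R Y x = 2 *\<^sub>R F Y x" by (simp only: Y(2))
      then show ?thesis by (simp add: F_apply)
    qed
    show "inner (Y x) y = inner x (Y y)" for x y
      using Y(1) unfolding D_def by blast
    show "Y (Z x) = Z (Y x)" if "bounded_linear Z" "\<And>x. K (Z x) = Z (K x)" for Z x
      using Y(1) that unfolding D_def C_def by blast
  qed
qed

text \<open>Uniqueness ranges over all nonnegative roots because that is what the description in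
  \<open>op_sqrt\<close> requires.\<close>

lemma positive_op_ex_sqrt:
  fixes T :: "'a::chilbert_space bop"
  assumes T: "positive_op T"
  shows "\<exists>R. positive_op R \<and> R * R = T \<and> (\<forall>S. nonneg_op S \<and> S * S = T \<longrightarrow> S = R)"
proof -
  let ?T = "bop_apply T"
  note lin = linear_bop_apply
  obtain \<epsilon> where \<epsilon>: "\<epsilon> > 0" "\<And>x. inner (?T x) x \<ge> \<epsilon> * (norm x)\<^sup>2"
    using positive_op_coercive[OF T] by blast
  obtain M where M: "M > 0" "\<And>x. norm (?T x) \<le> norm x * M"
    using bounded_linear.pos_bounded[OF bounded_linear_bop_apply] by blast
  \<comment> \<open>This \<open>t\<close> minimizes
    \<open>1 - 2 * t * \<epsilon> + t\<^sup>2 * M\<^sup>2\<close>, the bound for the squared norm of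
    \<open>K\<close>; the minimum is \<open>1 - t * \<epsilon>\<close>.\<close>
  define t where "t = \<epsilon> / M\<^sup>2"
  have t: "t > 0" using \<epsilon> M by (simp add: t_def)
  have blK: "bounded_linear (\<lambda>x. x - t *\<^sub>R ?T x)"
    by (intro bounded_linear_intros bounded_linear_bop_apply bounded_linear_sub bounded_linear_ident
        bounded_linear_const_scaleR)
  define K where "K = Blinfun (\<lambda>x. x - t *\<^sub>R ?T x)"
  have K: "K x = x - t *\<^sub>R ?T x" for x
    by (simp add: K_def bounded_linear_Blinfun_apply[OF blK])
  have sq: "(norm (K x))\<^sup>2 \<le> (1 - t * \<epsilon>) * (norm x)\<^sup>2" for x
  proof -
    have "(norm (K x))\<^sup>2 = (norm x)\<^sup>2 - 2 * t * inner (?T x) x + t\<^sup>2 * (norm (?T x))\<^sup>2"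
      unfolding K power2_norm_eq_inner
      by (simp add: inner_diff_left inner_diff_right inner_commute power2_eq_square algebra_simps)
    also have "\<dots> \<le> (norm x)\<^sup>2 - 2 * t * (\<epsilon> * (norm x)\<^sup>2) + t\<^sup>2 * (norm x * M)\<^sup>2"
      using t \<epsilon>(2)[of x] M(2)[of x]
      by (intro add_mono diff_mono mult_left_mono power_mono) auto
    also have "t\<^sup>2 * (norm x * M)\<^sup>2 = t * \<epsilon> * (norm x)\<^sup>2"
      using M(1) by (simp add: t_def power2_eq_square)
    finally show ?thesis by (simp add: algebra_simps)
  qed
  have "norm K < 1"
  proof -
    \<comment> \<open>The maximum keeps the radicand nonnegative; on the zero space
      \<open>1 - t * \<epsilon>\<close> may be negative.\<close>
    have "norm (K x) \<le> sqrt (max 0 (1 - t * \<epsilon>)) * norm x" for x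
    proof (rule power2_le_imp_le)
      have "(1 - t * \<epsilon>) * (norm x)\<^sup>2 \<le> max 0 (1 - t * \<epsilon>) * (norm x)\<^sup>2"
        by (intro mult_right_mono) auto
      with sq[of x] show "(norm (K x))\<^sup>2 \<le> (sqrt (max 0 (1 - t * \<epsilon>)) * norm x)\<^sup>2"
        by (simp add: power_mult_distrib)
    qed simp
    then have "norm K \<le> sqrt (max 0 (1 - t * \<epsilon>))"
      by (intro norm_blinfun_bound) auto
    also have "\<dots> < 1" using t \<epsilon>(1) by simp
    finally show ?thesis .
  qed
  moreover have "inner (K x) y = inner x (K y)" for x y
    using nonneg_op_inner_symmetric[OF positive_imp_nonneg_op[OF T]]
    by (simp add: K inner_diff_left inner_diff_right)
  ultimately obtain Y :: "'a \<Rightarrow>\<^sub>L 'a" where normY: "norm Y < 1"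
    and fixY: "\<And>x. 2 *\<^sub>R Y x = K x + Y (Y x)"
    and symY: "\<And>x y. inner (Y x) y = inner x (Y y)"
    and commY: "\<And>Z x. bounded_linear Z \<Longrightarrow> (\<And>x. K (Z x) = Z (K x)) \<Longrightarrow> Y (Z x) = Z (Y x)"
    using blinfun_square_fixed_point[of K] by blast
  have commY': "Y (Z x) = Z (Y x)"
    if Z: "bounded_linear Z" "\<And>x. ?T (Z x) = Z (?T x)" for Z x
  proof (rule commY[OF Z(1)])
    show "K (Z x) = Z (K x)" for x
      using bounded_linear.linear[OF Z(1)] Z(2) by (simp add: K linear_diff linear_cmul)
  qed
  \<comment> \<open>\<open>Y\<close> is so far only real linear; complex scalars commute with
    \<open>T\<close>, hence with \<open>Y\<close>.\<close>
  have Y_scaleC: "Y (c *\<^sub>C x) = c *\<^sub>C Y x" for c x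
    by (rule commY'[OF bounded_linear_scaleC]) (simp add: bop_apply_scaleC)
  \<comment> \<open>Since \<open>(1 - Y)\<^sup>2 = 1 - K = t T\<close>, the factor \<open>r\<close>
    undoes the scaling by \<open>t\<close>.\<close>
  define r where "r = 1 / sqrt t"
  have r: "r > 0" "r * r * t = 1" using t by (simp_all add: r_def)
  define f where "f x = r *\<^sub>R (x - Y x)" for x
  have "bounded_linear f"
    unfolding f_def
    by (intro bounded_linear_const_scaleR bounded_linear_sub bounded_linear_ident
        blinfun.bounded_linear_right)
  moreover have "f (c *\<^sub>C x) = c *\<^sub>C f x" for c x
    unfolding f_def Y_scaleC
    by (simp add: linear_diff[OF bounded_linear.linear[OF bounded_linear_scaleC]]
        linear_cmul[OF bounded_linear.linear[OF bounded_linear_scaleC]])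
  ultimately have R: "bop_apply (Bop f) x = f x" for x
    by (simp add: Bop_inverse)
  have ff: "f (f x) = ?T x" for x
  proof -
    have "f (f x) = (r * r) *\<^sub>R (x - 2 *\<^sub>R Y x + Y (Y x))"
      unfolding f_def scaleR_2 by (simp add: blinfun.bilinear_simps algebra_simps)
    also have "\<dots> = (r * r) *\<^sub>R (t *\<^sub>R ?T x)"
      unfolding fixY by (simp add: K)
    finally show ?thesis using r(2) by simp
  qed
  have sqR: "Bop f * Bop f = T"
    by (rule bop_eqI) (simp add: R ff)
  have posf: "inner (f x) x > 0" if "x \<noteq> 0" for x
  proof -
    have "inner (Y x) x \<le> norm (Y x) * norm x" by (rule norm_cauchy_schwarz)
    also have "\<dots> \<le> norm Y * norm x * norm x"
      by (intro mult_right_mono norm_blinfun) simp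
    also have "\<dots> < 1 * norm x * norm x"
      using normY that by (intro mult_strict_right_mono) auto
    also have "\<dots> = inner x x"
      by (simp add: power2_norm_eq_inner[symmetric] power2_eq_square)
    finally show ?thesis using r(1) by (simp add: f_def inner_diff_left)
  qed
  have symf: "inner (f x) y = inner x (f y)" for x y
    by (simp add: f_def inner_diff_left inner_diff_right symY)
  have "positive_op (Bop f)"
  proof (rule positive_opI)
    let ?V = "op_inv T"
    note inv = positive_op_inv_left[OF T] positive_op_inv_right[OF T]
    show "cinner (bop_apply (Bop f) x) y = cinner x (bop_apply (Bop f) y)" for x y
      \<comment> \<open>The second instance supplies the imaginary parts.\<close>
      using symf[of x y] symf[of "\<i> *\<^sub>C x" y]
      by (simp add: complex_eq_iff inner_eq_Re_cinner[symmetric] Im_cinner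
          R[symmetric] bop_apply_scaleC)
    show "inner (bop_apply (Bop f) x) x > 0" if "x \<noteq> 0" for x
      using posf[OF that] by (simp add: R)
    show "(?V * Bop f) * Bop f = 1"
      by (simp add: mult.assoc sqR inv)
    \<comment> \<open>\<open>?V * Bop f\<close> is a left inverse; it is also a right inverse
      because \<open>Bop f\<close> commutes with its square \<open>T\<close>, hence with
      \<open>?V\<close>.\<close>
    have "T * Bop f = Bop f * T" by (metis sqR mult.assoc)
    then have "Bop f * ?V = ?V * Bop f"
      by (metis inv mult.assoc mult_1_left mult_1_right)
    then show "Bop f * (?V * Bop f) = 1"
      by (metis inv(1) sqR mult.assoc)
  qed
  moreover have "S = Bop f" if S: "nonneg_op S" "S * S = T" for S
  proof (rule bop_eqI)
    fix x
    let ?S = "bop_apply S"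
    have SS: "?S (?S x) = ?T x" for x using S(2) by auto
    \<comment> \<open>\<open>S\<close> commutes with \<open>T\<close> because \<open>T\<close> is
      its square.\<close>
    have "Y (?S x) = ?S (Y x)" for x
      by (rule commY'[OF bounded_linear_bop_apply]) (simp add: SS[symmetric])
    then have comm: "f (?S x) = ?S (f x)" for x
      by (simp add: f_def linear_cmul[OF lin] linear_diff[OF lin])
    \<comment> \<open>As \<open>S\<close> and \<open>f\<close> commute,
      \<open>(S + f) (S - f) = S\<^sup>2 - f\<^sup>2 = 0\<close>, so \<open>S + f\<close> kills
      \<open>d\<close>; strict positivity of \<open>f\<close> then forces
      \<open>d = 0\<close>.\<close>
    define d where "d = ?S x - f x"
    have "?S d + f d = 0"
      unfolding d_def
      using linear_diff[OF bounded_linear.linear[OF \<open>bounded_linear f\<close>]]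
      by (simp add: linear_diff[OF lin] SS ff comm)
    then have "inner (?S d) d + inner (f d) d = 0"
      by (metis inner_add_left inner_zero_left)
    with nonneg_op_inner_nonneg[OF S(1), of d] posf[of d] have "d = 0" by force
    then show "?S x = bop_apply (Bop f) x" by (simp add: d_def R)
  qed
  ultimately show ?thesis using sqR by blast
qed

lemma
  fixes T :: "'a::chilbert_space bop"
  assumes "positive_op T"
  shows positive_op_sqrt: "positive_op (op_sqrt T)"
    and op_sqrt_square: "op_sqrt T * op_sqrt T = T"
    and op_sqrt_eqI: "nonneg_op S \<Longrightarrow> S * S = T \<Longrightarrow> op_sqrt T = S"
proof -
  obtain R where R: "positive_op R" "R * R = T" "\<forall>S. nonneg_op S \<and> S * S = T \<longrightarrow> S = R"
    using positive_op_ex_sqrt[OF assms] by blast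
  have "op_sqrt T = R"
    unfolding op_sqrt_def
    by (rule the_equality) (use R positive_imp_nonneg_op in \<open>blast+\<close>)
  with R show "positive_op (op_sqrt T)" "op_sqrt T * op_sqrt T = T"
    "nonneg_op S \<Longrightarrow> S * S = T \<Longrightarrow> op_sqrt T = S" by simp_all
qed

section \<open>The equation\<close>

theorem theorem2p1:
  fixes A B :: "'a::chilbert_space bop"
  assumes "positive_op A" and "positive_op B"
  shows "positive_op (A \<natural> B) \<and>
    (A \<natural> B) * op_inv A * (A \<natural> B) = (op_abs (op_inv (op_sqrt A) * op_sqrt B * op_sqrt A))\<^sup>2 \<and>
    (\<forall>X. positive_op X \<and>
         X * op_inv A * X = (op_abs (op_inv (op_sqrt A) * op_sqrt B * op_sqrt A))\<^sup>2
         \<longrightarrow> X = A \<natural> B)"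
proof -
  define a b v where "a = op_sqrt A" and "b = op_sqrt B" and "v = op_inv a"
  have a: "positive_op a" and b: "positive_op b" and v: "positive_op v"
    using assms by (simp_all add: a_def b_def v_def positive_op_sqrt positive_op_inv)
  have aa: "a * a = A"
    using assms by (simp add: a_def op_sqrt_square)
  have va: "v * a = 1" and av: "a * v = 1"
    using a by (simp_all add: v_def positive_op_inv_left positive_op_inv_right)
  have va': "v * (a * Z) = Z" and av': "a * (v * Z) = Z" for Z
    using va av by (simp_all add: mult.assoc[symmetric])
  have invA: "op_inv A = v * v"
    by (rule op_inv_eqI) (simp_all add: aa[symmetric] mult.assoc va va' av av')
  define C where "C = b * op_inv A * b"
  have C: "positive_op C"
    unfolding C_def by (intro positive_op_congruence positive_op_inv b assms)
  define c where "c = op_sqrt C"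
  have c: "positive_op c" and cc: "c * c = C"
    using C by (simp_all add: c_def positive_op_sqrt op_sqrt_square)
  have nat: "A \<natural> B = a * c * a"
    by (simp add: op_natural_def a_def b_def c_def C_def)
  \<comment> \<open>The three factors are self-adjoint, so taking the adjoint only reverses their
    order.\<close>
  have "op_adj (v * b * a) = a * b * v"
    by (rule op_adj_eqI)
      (simp add: nonneg_op_symmetric[OF positive_imp_nonneg_op] a b v)
  then have "op_abs (v * b * a) = op_sqrt (a * C * a)"
    by (simp add: op_abs_def C_def invA mult.assoc)
  \<comment> \<open>\<open>a * C * a\<close> is positive, so squaring undoes its square root and the
    absolute value disappears.\<close>
  then have rhs: "(op_abs (v * b * a))\<^sup>2 = a * C * a"
    by (simp add: power2_eq_square op_sqrt_square positive_op_congruence a C)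
  have "a * c * a * op_inv A * (a * c * a) = a * (c * c) * a"
    by (simp add: invA mult.assoc va va' av av')
  then have eqn: "a * c * a * op_inv A * (a * c * a) = a * C * a"
    by (simp only: cc)
  have unique: "X = a * c * a" if X: "positive_op X" "X * op_inv A * X = a * C * a" for X
  proof -
    \<comment> \<open>Conjugation by \<open>v\<close> makes \<open>v * X * v\<close> a positive
      square root of \<open>C\<close>, so it must be \<open>c\<close>.\<close>
    have "v * X * v * (v * X * v) = v * (X * op_inv A * X) * v"
      by (simp add: invA mult.assoc)
    also have "\<dots> = C"
      unfolding X(2) by (simp add: mult.assoc va' av)
    finally have "c = v * X * v"
      unfolding c_def
      by (intro op_sqrt_eqI[OF C] positive_imp_nonneg_op positive_op_congruence v X(1))
    then show ?thesis by (simp add: mult.assoc va av')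
  qed
  show ?thesis
    unfolding a_def[symmetric] b_def[symmetric] v_def[symmetric] nat rhs
    by (intro conjI allI impI positive_op_congruence a c eqn) (rule unique; elim conjE)
qed

end
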